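(* Let $G$ be a normed gyrogroup. Then $G$ is homogeneous in the sense that if $x$ and $y$ are arbitrary points of $G$, then there is an isometry $T\colon G\to G$ with respect to the gyronorm metric (which is also a homeomorphism of $G$) such that $T(x)=y$.
   Context: A gyrogroup is a nonempty set $G$ with a binary operation $\oplus$ such that: (G1) there is an element $e\in G$ with $e\oplus a=a$ for all $a\in G$; (G2) for each $a\in G$ there is $b\in G$ with $b\oplus a=e$; (G3) for all $a,b\in G$ there is an automorphism $\mathrm{gyr}[a,b]$ of $(G,\oplus)$ (a bijection $G\to G$ preserving $\oplus$) such that $a\oplus(b\oplus c)=(a\oplus b)\oplus\mathrm{gyr}[a,b]c$ for all $c\in G$; (G4) $\mathrm{gyr}[a\oplus b,b]=\mathrm{gyr}[a,b]$ for all $a,b\in G$. Then $e$ is the unique two-sided identity and each $a$ has a unique two-sided inverse $\ominus a$; $\mathrm{gyr}[a,b]$ is called the gyroautomorphism generated by $a$ and $b$. A gyronorm on a gyrogroup $G$ is a function $\|\cdot\|\colon G\to\mathbb{R}$ such that: (1) $\|x\|\ge 0$ for all $x\in G$, and $\|x\|=0$ if and only if $x=e$; (2) $\|\ominus x\|=\|x\|$ for all $x\in G$; (3) $\|x\oplus y\|\le\|x\|+\|y\|$ for all $x,y\in G$; (4) $\|\mathrm{gyr}[a,b]x\|=\|x\|$ for all $a,b,x\in G$. A normed gyrogroup is a gyrogroup equipped with a gyronorm; its gyronorm metric is $d(x,y)=\|\ominus x\oplus y\|$, and $G$ carries the topology induced by $d$. An isometry of $G$ is a distance-preserving bijection of $(G,d)$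 onto itself. *)

theory Defs
  imports "HOL-Analysis.Analysis"
begin

text \<open>
  The identity and the gyrations are carried as parameters. Both are determined on \<open>G\<close> by the
  axioms: \<open>e\<close> is the unique identity, and \<open>gyr a b\<close> is unique by left cancellation.
\<close>

locale gyrogroup =
  fixes G :: "'a set"
    and gplus :: "'a \<Rightarrow> 'a \<Rightarrow> 'a" (infixl "\<oplus>" 65)
    and e :: 'a
    and gyr :: "'a \<Rightarrow> 'a \<Rightarrow> 'a \<Rightarrow> 'a"
  assumes gplus_closed: "\<lbrakk>a \<in> G; b \<in> G\<rbrakk> \<Longrightarrow> a \<oplus> b \<in> G"
    and e_closed: "e \<in> G"
    and left_identity: "a \<in> G \<Longrightarrow> e \<oplus> a = a"
    and left_inverse_ex: "a \<in> G \<Longrightarrow> \<exists>b\<in>G. b \<oplus> a = e"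
    and gyr_bij: "\<lbrakk>a \<in> G; b \<in> G\<rbrakk> \<Longrightarrow> bij_betw (gyr a b) G G"
    and gyr_hom: "\<lbrakk>a \<in> G; b \<in> G; c \<in> G; d \<in> G\<rbrakk>
                    \<Longrightarrow> gyr a b (c \<oplus> d) = gyr a b c \<oplus> gyr a b d"
    and gyroassoc: "\<lbrakk>a \<in> G; b \<in> G; c \<in> G\<rbrakk> \<Longrightarrow> a \<oplus> (b \<oplus> c) = (a \<oplus> b) \<oplus> gyr a b c"
    and left_loop: "\<lbrakk>a \<in> G; b \<in> G; c \<in> G\<rbrakk> \<Longrightarrow> gyr (a \<oplus> b) b c = gyr a b c"
begin

definition ominus :: "'a \<Rightarrow> 'a" where
  "ominus a = (THE b. b \<in> G \<and> b \<oplus> a = e \<and> a \<oplus> b = e)"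

lemma gyr_closed: "\<lbrakk>a \<in> G; b \<in> G; c \<in> G\<rbrakk> \<Longrightarrow> gyr a b c \<in> G"
  using gyr_bij bij_betwE by blast

lemma left_cancel:
  assumes "a \<in> G" "x \<in> G" "y \<in> G" "a \<oplus> x = a \<oplus> y"
  shows "x = y"
proof -
  obtain b where b: "b \<in> G" "b \<oplus> a = e"
    using left_inverse_ex assms(1) by blast
  have *: "b \<oplus> (a \<oplus> z) = gyr b a z" if "z \<in> G" for z
    using gyroassoc[of b a z] b assms(1) that gyr_closed left_identity by simp
  have "gyr b a x = gyr b a y"
    using *[OF assms(2)] *[OF assms(3)] assms(4) by simp
  then show ?thesis
    using gyr_bij[OF b(1) assms(1)] assms(2,3) by (auto simp: bij_betw_def dest: inj_onD)
qed

lemma left_inverse_cancel: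
  assumes "a \<in> G" "b \<in> G" "b \<oplus> a = e" "x \<in> G"
  shows "b \<oplus> (a \<oplus> x) = x"
proof -
  have "a \<oplus> x = a \<oplus> gyr e a x"
    using gyroassoc[of e a x] assms e_closed left_identity gplus_closed by simp
  then have "gyr e a x = x"
    using left_cancel assms gyr_closed e_closed by metis
  then have "gyr b a x = x"
    using left_loop[of b a x] assms by simp
  then show ?thesis
    using gyroassoc[of b a x] assms left_identity by simp
qed

lemma right_identity:
  assumes "a \<in> G"
  shows "a \<oplus> e = a"
proof -
  obtain b where b: "b \<in> G" "b \<oplus> a = e"
    using left_inverse_ex assms by blast
  show ?thesis
    using left_inverse_cancel[OF assms b e_closed] b left_cancel assms gplus_closed e_closed
    by metis
qed

lemma left_inverse_is_right_inverse:
  assumes "a \<in> G" "b \<in> G" "b \<oplus> a = e"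
  shows "a \<oplus> b = e"
  using left_inverse_cancel[OF assms assms(2)] right_identity[OF assms(2)] left_cancel assms
    gplus_closed e_closed by metis

lemma ominus:
  assumes "a \<in> G"
  shows "ominus a \<in> G" "ominus a \<oplus> a = e" "a \<oplus> ominus a = e"
proof -
  obtain b where b: "b \<in> G" "b \<oplus> a = e"
    using left_inverse_ex assms by blast
  have "\<exists>!b. b \<in> G \<and> b \<oplus> a = e \<and> a \<oplus> b = e"
    using b left_inverse_is_right_inverse[OF assms b] left_cancel assms by metis
  from theI'[OF this]
  show "ominus a \<in> G" "ominus a \<oplus> a = e" "a \<oplus> ominus a = e"
    unfolding ominus_def by blast+
qed

lemma ominus_unique:
  assumes "a \<in> G" "b \<in> G" "a \<oplus> b = e"
  shows "ominus a = b"
  using ominus[OF assms(1)] left_cancel assms by metis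

lemma ominus_ominus:
  assumes "a \<in> G"
  shows "ominus (ominus a) = a"
  using ominus_unique ominus assms by blast

lemma gyrosum_inversion:
  assumes "a \<in> G" "b \<in> G"
  shows "ominus (a \<oplus> b) = gyr a b (ominus b \<oplus> ominus a)"
proof (rule ominus_unique)
  have "b \<oplus> (ominus b \<oplus> ominus a) = ominus a"
    using left_inverse_cancel ominus assms by blast
  then show "(a \<oplus> b) \<oplus> gyr a b (ominus b \<oplus> ominus a) = e"
    using gyroassoc[of a b "ominus b \<oplus> ominus a"] assms ominus gplus_closed by simp
qed (use assms ominus gplus_closed gyr_closed in auto)

end

locale normed_gyrogroup = gyrogroup +
  fixes gyronorm :: "'a \<Rightarrow> real"
  assumes gyronorm_nonneg: "x \<in> G \<Longrightarrow> 0 \<le> gyronorm x"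
    and gyronorm_eq_0_iff: "x \<in> G \<Longrightarrow> gyronorm x = 0 \<longleftrightarrow> x = e"
    and gyronorm_ominus: "x \<in> G \<Longrightarrow> gyronorm (ominus x) = gyronorm x"
    and gyronorm_triangle:
      "\<lbrakk>x \<in> G; y \<in> G\<rbrakk> \<Longrightarrow> gyronorm (x \<oplus> y) \<le> gyronorm x + gyronorm y"
    and gyronorm_gyr:
      "\<lbrakk>a \<in> G; b \<in> G; x \<in> G\<rbrakk> \<Longrightarrow> gyronorm (gyr a b x) = gyronorm x"
begin

text \<open>
  The value 0 off \<open>G\<close> is a mere convention: \<^locale>\<open>Metric_space\<close> demands nonnegativity and
  symmetry on the whole type, not only on the carrier.
\<close>

definition gyrometric :: "'a \<Rightarrow> 'a \<Rightarrow> real" where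
  "gyrometric x y = (if x \<in> G \<and> y \<in> G then gyronorm (ominus x \<oplus> y) else 0)"

lemma gyrometric_Metric_space: "Metric_space G gyrometric"
proof
  fix x y
  show "0 \<le> gyrometric x y"
    by (simp add: gyrometric_def gyronorm_nonneg ominus gplus_closed)
  have "gyronorm (ominus x \<oplus> y) = gyronorm (ominus y \<oplus> x)" if "x \<in> G" "y \<in> G"
    using that gyrosum_inversion[of "ominus x" y] gyronorm_ominus[of "ominus x \<oplus> y"]
    by (simp add: gyronorm_gyr ominus gplus_closed ominus_ominus)
  then show "gyrometric x y = gyrometric y x"
    by (simp add: gyrometric_def)
next
  fix x y
  assume xy: "x \<in> G" "y \<in> G"
  have "ominus x \<oplus> y = e \<longleftrightarrow> x = y"
    using xy ominus left_cancel by metis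
  then show "gyrometric x y = 0 \<longleftrightarrow> x = y"
    using xy by (simp add: gyrometric_def gyronorm_eq_0_iff ominus gplus_closed)
next
  fix x y z
  assume xyz: "x \<in> G" "y \<in> G" "z \<in> G"
  have "y \<oplus> (ominus y \<oplus> z) = z"
    using left_inverse_cancel ominus xyz by blast
  then have "ominus x \<oplus> z = (ominus x \<oplus> y) \<oplus> gyr (ominus x) y (ominus y \<oplus> z)"
    using gyroassoc[of "ominus x" y "ominus y \<oplus> z"] xyz ominus gplus_closed by simp
  then show "gyrometric x z \<le> gyrometric x y + gyrometric y z"
    using xyz gyronorm_triangle[of "ominus x \<oplus> y" "gyr (ominus x) y (ominus y \<oplus> z)"]
    by (simp add: gyrometric_def gyronorm_gyr gyr_closed ominus gplus_closed)
qed

definition gyro_topology :: "'a topology" where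
  "gyro_topology = Metric_space.mtopology G gyrometric"

definition gyro_isometry :: "('a \<Rightarrow> 'a) \<Rightarrow> bool" where
  "gyro_isometry T \<longleftrightarrow>
     bij_betw T G G \<and> (\<forall>u\<in>G. \<forall>v\<in>G. gyrometric (T u) (T v) = gyrometric u v)"

end

end

theory Submission
  imports Defs
begin

text \<open>
  Left translations are isometries because of the gyrogroup identity
  \<open>\<ominus>(a \<oplus> b) \<oplus> (a \<oplus> c) = gyr[a,b](\<ominus>b \<oplus> c)\<close> and the invariance of the gyronorm under gyrations.
  The translation by \<open>\<ominus>x\<close> followed by the one by \<open>y\<close> takes \<open>x\<close> through \<open>e\<close> to \<open>y\<close>.
\<close>

context gyrogroup
begin

text \<open>Expanding \<open>c\<close> as \<open>b \<oplus> (ominus b \<oplus> c)\<close> lets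
  gyroassociativity exhibit \<open>a \<oplus> b\<close> as a left factor of
  \<open>a \<oplus> c\<close>, which then cancels.\<close>

lemma translation_difference:
  assumes "a \<in> G" "b \<in> G" "c \<in> G"
  shows "ominus (a \<oplus> b) \<oplus> (a \<oplus> c) = gyr a b (ominus b \<oplus> c)"
proof -
  let ?g = "gyr a b (ominus b \<oplus> c)"
  have "b \<oplus> (ominus b \<oplus> c) = c"
    using left_inverse_cancel ominus assms by blast
  then have "a \<oplus> c = (a \<oplus> b) \<oplus> ?g"
    using gyroassoc[of a b "ominus b \<oplus> c"] assms ominus gplus_closed by simp
  moreover have "ominus (a \<oplus> b) \<oplus> ((a \<oplus> b) \<oplus> ?g) = ?g"
    using assms by (intro left_inverse_cancel) (simp_all add: ominus gplus_closed gyr_closed)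
  ultimately show ?thesis
    by simp
qed

lemma translation_bij:
  assumes "a \<in> G"
  shows "bij_betw (\<lambda>u. a \<oplus> u) G G"
proof (rule bij_betw_byWitness[where f' = "\<lambda>u. ominus a \<oplus> u"])
  show "\<forall>u\<in>G. ominus a \<oplus> (a \<oplus> u) = u" "\<forall>u\<in>G. a \<oplus> (ominus a \<oplus> u) = u"
    \<comment> \<open>The second identity exchanges the roles: \<open>a\<close> is itself a left
      inverse of \<open>ominus a\<close>.\<close>
    using left_inverse_cancel ominus assms by blast+
qed (use assms ominus gplus_closed in auto)

end

context normed_gyrogroup
begin

lemma translation_isometry:
  assumes "a \<in> G"
  shows "gyro_isometry (\<lambda>u. a \<oplus> u)"
  using assms
  by (simp add: gyro_isometry_def translation_bij gyrometric_def translation_difference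
      gyronorm_gyr ominus gplus_closed)

lemma gyro_isometry_comp:
  assumes "gyro_isometry S" "gyro_isometry T"
  shows "gyro_isometry (S \<circ> T)"
  using assms bij_betw_trans[of T G G S G] bij_betwE[of T G G]
  by (simp add: gyro_isometry_def)

text \<open>Since \<open>T\<close> maps onto \<open>G\<close>, its inverse preserves distances too,
  so both are continuous.\<close>

lemma gyro_isometry_homeomorphic_map:
  assumes "gyro_isometry T"
  shows "homeomorphic_map gyro_topology gyro_topology T"
proof -
  interpret Metric_space12 G gyrometric G gyrometric
    by (intro Metric_space12.intro gyrometric_Metric_space)
  show ?thesis
    unfolding gyro_topology_def
    using assms
    by (intro isometry_imp_homeomorphic_map)
      (auto simp: gyro_isometry_def bij_betw_def)
qed

end

theorem theorem4p5:
  fixes G :: "'a set"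
    and gplus :: "'a \<Rightarrow> 'a \<Rightarrow> 'a"
    and e :: 'a
    and gyr :: "'a \<Rightarrow> 'a \<Rightarrow> 'a \<Rightarrow> 'a"
    and gyronorm :: "'a \<Rightarrow> real"
    and x y :: 'a
  assumes "normed_gyrogroup G gplus e gyr gyronorm"
    and "x \<in> G" and "y \<in> G"
  shows "\<exists>T. normed_gyrogroup.gyro_isometry G gplus e gyronorm T
           \<and> homeomorphic_map (normed_gyrogroup.gyro_topology G gplus e gyronorm)
                (normed_gyrogroup.gyro_topology G gplus e gyronorm) T
           \<and> T x = y"
proof -
  interpret normed_gyrogroup G gplus e gyr gyronorm
    by (rule assms(1))
  let ?T = "gplus y \<circ> gplus (ominus x)"
  have "gyro_isometry ?T"
    using assms by (intro gyro_isometry_comp translation_isometry) (auto simp: ominus)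
  \<comment> \<open>The last step \<open>y \<oplus> e = y\<close> rests on the right identity law,
    which is derived from the left-sided axioms.\<close>
  moreover have "?T x = y"
    using assms by (simp add: ominus right_identity)
  ultimately show ?thesis
    using gyro_isometry_homeomorphic_map by blast
qed

end
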